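(* For each integer $h\ge1$, one has (as formal power series in $q$) $$\tilde a_h(q)=(-q;q)_\infty\sum_{j=0}^{\lceil h/2\rceil-1}q^h\binom{h-j-1}{j}_{q^2}\sum_{m\ge0}(q^{2m+1};q^2)_j\,q^{(2h-4j)m}$$ $$\qquad\qquad+(-q;q)_\infty\sum_{j=0}^{\lfloor h/2\rfloor-1}q^{3h-4j-3}\binom{h-j-2}{j}_{q^2}\sum_{m\ge0}(q^{2m+3};q^2)_j\,q^{(2h-4j-2)m}$$ and $$\tilde b_h(q)=(-q;q)_\infty\sum_{j=0}^{\lceil h/2\rceil-1}q^{h+j(j-1)/2}\binom{h-j-1}{j}_q\sum_{m\ge0}\frac{q^{(j+1)m}}{(-q^{m+1};q)_{h-j}}.$$
   Context: A partition $\lambda=(\lambda_1\ge\lambda_2\ge\dots\ge\lambda_\ell>0)$ of $n$ is drawn as its Ferrers diagram: left-adjusted rows of boxes, with $\lambda_i$ boxes in row $i$. The hook number of the box in row $i$ and column $j$ is the number of boxes in the L-shape consisting of that box, all boxes to its right in the same row, and all boxes below it in the same column. $\mathcal H(\lambda)$ denotes the multiset of all hook numbers of $\lambda$. Let $\mathcal O(n)$ be the set of partitions of $n$ all of whose parts are odd and $\mathcal D(n)$ the set of partitions of $n$ whose parts are pairwise distinct. For integers $h\ge1$ and $n\ge0$, define $$a_h(n)=\sum_{\lambda\in\mathcal O(n)}\#\{x\in\mathcal H(\lambda):x=h\},\qquad b_h(n)=\sum_{\lambda\in\mathcal D(n)}\#\{x\in\mathcal H(\lambda):x=h\},$$ counted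 with multiplicity, and set $\tilde a_h(q)=\sum_{n\ge0}a_h(n)q^n$, $\tilde b_h(q)=\sum_{n\ge0}b_h(n)q^n$. Notation: $(x;q)_0=1$, $(x;q)_n=\prod_{j=0}^{n-1}(1-xq^j)$ for $n\ge1$, $(x;q)_\infty=\lim_{n\to\infty}(x;q)_n$; for $0\le k\le n$, $\binom nk_q=\frac{(q;q)_n}{(q;q)_k(q;q)_{n-k}}$, and $\binom nk_{q^2}$ is this expression with $q$ replaced by $q^2$. Empty sums are $0$. *)

theory Defs
  imports "HOL-Computational_Algebra.Formal_Power_Series" "HOL-Library.Multiset"
begin

definition is_partition :: "nat list \<Rightarrow> nat \<Rightarrow> bool" where
  "is_partition lam n \<longleftrightarrow> sorted_wrt (\<ge>) lam \<and> (\<forall>p\<in>set lam. p > 0) \<and> sum_list lam = n"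

text \<open>Rows and columns are numbered from 0, so row \<open>i\<close> consists of the boxes
  \<open>(i, 0), \<dots>, (i, lam ! i - 1)\<close>.\<close>

definition ferrers :: "nat list \<Rightarrow> (nat \<times> nat) set" where
  "ferrers lam = {(i, j). i < length lam \<and> j < lam ! i}"

definition hook :: "nat list \<Rightarrow> nat \<times> nat \<Rightarrow> (nat \<times> nat) set" where
  "hook lam = (\<lambda>(i, j). {(i', j') \<in> ferrers lam. (i' = i \<and> j' \<ge> j) \<or> (j' = j \<and> i' \<ge> i)})"

definition hook_number :: "nat list \<Rightarrow> nat \<times> nat \<Rightarrow> nat" where
  "hook_number lam b = card (hook lam b)"

definition hook_numbers :: "nat list \<Rightarrow> nat multiset" where
  "hook_numbers lam = image_mset (hook_number lam) (mset_set (ferrers lam))"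

definition odd_partitions :: "nat \<Rightarrow> nat list set" where
  "odd_partitions n = {lam. is_partition lam n \<and> (\<forall>p\<in>set lam. odd p)}"

definition distinct_partitions :: "nat \<Rightarrow> nat list set" where
  "distinct_partitions n = {lam. is_partition lam n \<and> distinct lam}"

text \<open>The sets being summed over and counted in below are finite, so \<^const>\<open>sum\<close>, \<^const>\<open>card\<close> and
  \<^const>\<open>mset_set\<close> do not fall back to their default values on infinite sets.\<close>

lemma finite_ferrers: "finite (ferrers lam)"
proof -
  have "ferrers lam = (SIGMA i:{..<length lam}. {..<lam ! i})"
    by (auto simp: ferrers_def)
  then show ?thesis by simp
qed

lemma finite_partitions: "finite {lam. is_partition lam n}"
proof (rule finite_subset)
  have "length lam \<le> sum_list lam" if "\<forall>p\<in>set lam. p > 0" for lam :: "nat list"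
    using that by (induction lam) (auto simp: Suc_le_eq)
  then show "{lam. is_partition lam n} \<subseteq> {lam. set lam \<subseteq> {..n} \<and> length lam \<le> n}"
    by (auto simp: is_partition_def dest: member_le_sum_list)
qed (simp add: finite_lists_length_le)

lemma finite_odd_partitions: "finite (odd_partitions n)"
  and finite_distinct_partitions: "finite (distinct_partitions n)"
  by (rule finite_subset[OF _ finite_partitions[of n]];
      auto simp: odd_partitions_def distinct_partitions_def)+

definition a_hook :: "nat \<Rightarrow> nat \<Rightarrow> nat" where
  "a_hook h n = (\<Sum>lam\<in>odd_partitions n. count (hook_numbers lam) h)"

definition b_hook :: "nat \<Rightarrow> nat \<Rightarrow> nat" where
  "b_hook h n = (\<Sum>lam\<in>distinct_partitions n. count (hook_numbers lam) h)"

definition a_gf :: "nat \<Rightarrow> rat fps" where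
  "a_gf h = Abs_fps (\<lambda>n. of_nat (a_hook h n))"

definition b_gf :: "nat \<Rightarrow> rat fps" where
  "b_gf h = Abs_fps (\<lambda>n. of_nat (b_hook h n))"

definition qpoch :: "rat fps \<Rightarrow> rat fps \<Rightarrow> nat \<Rightarrow> rat fps" where
  "qpoch x q n = (\<Prod>j<n. 1 - x * q ^ j)"

text \<open>The limit is taken in the \<open>X\<close>-adic topology on formal power series.\<close>

definition qpoch_inf :: "rat fps \<Rightarrow> rat fps \<Rightarrow> rat fps" where
  "qpoch_inf x q = lim (\<lambda>n. qpoch x q n)"

text \<open>Intended for \<open>k \<le> n\<close> and for \<open>q\<close> with zero constant coefficient, when the denominator
  is a unit.\<close>

definition qbinom :: "rat fps \<Rightarrow> nat \<Rightarrow> nat \<Rightarrow> rat fps" where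
  "qbinom q n k = qpoch q q n / (qpoch q q k * qpoch q q (n - k))"

end

(*
  A box with hook number h cuts a partition into hi @ s # mid @ lo, where s is the row of the box:
  if the box lies in column j (counted from 0), the rows of its leg are the parts in mid, which
  exceed j, the parts in lo are at most j, and h = (s - j) + length mid. The three lists can be
  chosen independently. For fixed l = length mid and j, the lists hi and lo together contribute the
  generating function of all partitions of the given kind with the factors of the parts between j
  and s removed; the latter form an arithmetic progression, so they give a q-Pochhammer symbol, and
  the lists mid give a q-binomial coefficient. By Euler's theorem the generating function of all
  partitions is (-q; q)_infinity for odd parts as well as for distinct parts. In the odd case the
  parity of h - l determines that of j, whence the two sums; m enumerates the columns j.
*)
theory Submission
  imports Defs "HOL-Library.Disjoint_Sets"
begin

unbundle fps_syntax

section \<open>Infinite sums of formal power series\<close>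

lemma fps_sums_iff:
  fixes f :: "nat \<Rightarrow> 'a :: comm_ring_1 fps"
  shows "f sums s \<longleftrightarrow> (\<forall>n. \<forall>\<^sub>F k in sequentially. (\<Sum>i<k. f i $ n) = s $ n)"
  by (simp add: sums_def tendsto_fps_iff fps_sum_nth)

text \<open>Coefficient \<open>n\<close> of a product with \<open>c\<close> involves only
  coefficients 0 to \<open>n\<close> of the partial sums. These are finitely many, so from some
  \<open>k\<close> on all of them are stable at once.\<close>

lemma fps_sums_mult:
  fixes f :: "nat \<Rightarrow> 'a :: comm_ring_1 fps"
  assumes "f sums s"
  shows "(\<lambda>m. c * f m) sums (c * s)"
proof -
  have "\<forall>\<^sub>F k in sequentially. (\<Sum>i<k. (c * f i) $ n) = (c * s) $ n" for n
  proof -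
    have "\<forall>\<^sub>F k in sequentially. \<forall>i\<in>{..n}. (\<Sum>m<k. f m $ i) = s $ i"
      using assms by (simp add: fps_sums_iff eventually_ball_finite)
    then show ?thesis
    proof eventually_elim
      case (elim k)
      have "(\<Sum>m<k. (c * f m) $ n) = (\<Sum>i=0..n. c $ i * (\<Sum>m<k. f m $ (n - i)))"
        by (simp add: fps_mult_nth sum_distrib_left sum.swap[of _ "{..<k}"])
      also have "\<dots> = (c * s) $ n"
        using elim by (simp add: fps_mult_nth)
      finally show ?case .
    qed
  qed
  then show ?thesis
    by (simp add: fps_sums_iff)
qed

text \<open>Since \<open>c > 0\<close>, the term of index \<open>m\<close> is divisible by
  \<open>fps_X ^ m\<close>, so coefficient \<open>n\<close> of the sum is settled by the terms of
  index at most \<open>n\<close>.\<close>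

lemma fps_summable_powers:
  fixes g :: "nat \<Rightarrow> 'a :: comm_ring_1 fps"
  assumes "c > 0"
  shows "summable (\<lambda>m. g m * fps_X ^ (c * m))"
proof -
  have "(\<lambda>m. g m * fps_X ^ (c * m)) sums
      Abs_fps (\<lambda>n. \<Sum>i\<le>n. (g i * fps_X ^ (c * i)) $ n)"
    unfolding fps_sums_iff
  proof
    fix n
    show "\<forall>\<^sub>F k in sequentially. (\<Sum>i<k. (g i * fps_X ^ (c * i)) $ n) =
        Abs_fps (\<lambda>n. \<Sum>i\<le>n. (g i * fps_X ^ (c * i)) $ n) $ n"
    proof (rule eventually_sequentiallyI)
      fix k assume "Suc n \<le> k"
      have "(g i * fps_X ^ (c * i)) $ n = 0" if "n < i" for i
      proof -
        have "n < c * i"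
          using that assms by (metis One_nat_def Suc_leI less_le_trans mult_le_mono1 nat_mult_1)
        then show ?thesis
          by (simp add: fps_X_power_mult_right_nth)
      qed
      then show "(\<Sum>i<k. (g i * fps_X ^ (c * i)) $ n) =
          Abs_fps (\<lambda>n. \<Sum>i\<le>n. (g i * fps_X ^ (c * i)) $ n) $ n"
        using \<open>Suc n \<le> k\<close> by (auto intro!: sum.mono_neutral_right simp: not_le[symmetric])
    qed
  qed
  then show ?thesis
    by (rule sums_summable)
qed

lemma fps_suminf_mult_powers:
  fixes g :: "nat \<Rightarrow> 'a :: comm_ring_1 fps"
  assumes "c > 0"
  shows "(\<Sum>m. C * (g m * fps_X ^ (c * m))) = C * (\<Sum>m. g m * fps_X ^ (c * m))"
  using fps_sums_mult[OF summable_sums[OF fps_summable_powers[OF assms, of g]], of C]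
  by (simp add: sums_iff)

text \<open>Congruence modulo \<open>fps_X ^ Suc n\<close> fixes coefficients 0 to \<open>n\<close>
  of \<open>f n\<close>. The infinite product is evaluated below in this form.\<close>

lemma fps_tendsto_power_dvd:
  fixes f :: "nat \<Rightarrow> 'a :: comm_ring_1 fps"
  assumes "\<And>n. fps_X ^ Suc n dvd f n - s"
  shows "f \<longlonglongrightarrow> s"
proof (rule tendsto_fpsI)
  fix k
  show "\<forall>\<^sub>F n in sequentially. f n $ k = s $ k"
  proof (rule eventually_sequentiallyI)
    fix n assume "k \<le> n"
    obtain u where "f n - s = fps_X ^ Suc n * u"
      using assms[of n] by (auto elim: dvdE)
    then have "(f n - s) $ k = 0"
      using \<open>k \<le> n\<close> by (simp add: fps_X_power_mult_nth del: power_Suc)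
    then show "f n $ k = s $ k"
      by simp
  qed
qed

section \<open>Generating functions of weighted sets\<close>

definition gf :: "('a \<Rightarrow> nat) \<Rightarrow> 'a set \<Rightarrow> rat fps" where
  "gf w A = Abs_fps (\<lambda>n. of_nat (card {x \<in> A. w x = n}))"

text \<open>\<open>card\<close> is 0 on an infinite set; under this condition the coefficients of
  \<open>gf\<close> are true counts.\<close>

definition finite_fibres :: "('a \<Rightarrow> nat) \<Rightarrow> 'a set \<Rightarrow> bool" where
  "finite_fibres w A \<longleftrightarrow> (\<forall>n. finite {x \<in> A. w x = n})"

lemma finite_fibres_subset: "finite_fibres w B \<Longrightarrow> A \<subseteq> B \<Longrightarrow> finite_fibres w A"
  unfolding finite_fibres_def
  by (intro allI finite_subset[of "{x \<in> A. w x = n}" "{x \<in> B. w x = n}" for n]) auto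

lemma gf_nth: "gf w A $ n = of_nat (card {x \<in> A. w x = n})"
  by (simp add: gf_def)

lemma gf_image:
  assumes "inj_on f A" "\<And>x. x \<in> A \<Longrightarrow> w (f x) = w' x"
  shows "gf w (f ` A) = gf w' A"
proof (rule fps_ext)
  fix n
  have "{x \<in> f ` A. w x = n} = f ` {x \<in> A. w' x = n}"
    using assms(2) by auto
  moreover have "inj_on f {x \<in> A. w' x = n}"
    using assms(1) by (rule inj_on_subset) auto
  ultimately show "gf w (f ` A) $ n = gf w' A $ n"
    by (simp add: gf_nth card_image)
qed

lemma gf_shift: "gf (\<lambda>x. c + w x) A = fps_X ^ c * gf w A"
proof (rule fps_ext)
  fix n
  have "{x \<in> A. c + w x = n} = (if n < c then {} else {x \<in> A. w x = n - c})"
    by auto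
  then show "gf (\<lambda>x. c + w x) A $ n = (fps_X ^ c * gf w A) $ n"
    by (simp add: gf_nth fps_X_power_mult_nth)
qed

lemma gf_UN_finite:
  assumes "finite I" "disjoint_family_on A I" "\<And>i. i \<in> I \<Longrightarrow> finite_fibres w (A i)"
  shows "gf w (\<Union>i\<in>I. A i) = (\<Sum>i\<in>I. gf w (A i))"
proof (rule fps_ext)
  fix n
  have "{x \<in> (\<Union>i\<in>I. A i). w x = n} = (\<Union>i\<in>I. {x \<in> A i. w x = n})"
    by auto
  also have "card \<dots> = (\<Sum>i\<in>I. card {x \<in> A i. w x = n})"
    using assms by (intro card_UN_disjoint) (auto simp: disjoint_family_on_def finite_fibres_def)
  finally show "gf w (\<Union>i\<in>I. A i) $ n = (\<Sum>i\<in>I. gf w (A i)) $ n"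
    by (simp add: gf_nth fps_sum_nth)
qed

lemma gf_Un:
  assumes "A \<inter> B = {}" "finite_fibres w A" "finite_fibres w B"
  shows "gf w (A \<union> B) = gf w A + gf w B"
  using assms gf_UN_finite[of "UNIV :: bool set" "\<lambda>b. if b then A else B" w]
  by (simp add: disjoint_family_on_def UNIV_bool Un_commute Int_commute add.commute split: if_splits)

text \<open>Only finitely many elements have weight \<open>n\<close>, so finitely many of the
  \<open>A m\<close> contain them all, and coefficient \<open>n\<close> of the partial sums stops
  changing.\<close>

lemma gf_UN_sums:
  fixes A :: "nat \<Rightarrow> 'a set"
  assumes "disjoint_family A" "finite_fibres w (\<Union>m. A m)"
  shows "(\<lambda>m. gf w (A m)) sums gf w (\<Union>m. A m)"
  unfolding fps_sums_iff
proof
  fix n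
  let ?S = "{x \<in> (\<Union>m. A m). w x = n}"
  have fin: "finite ?S"
    using assms(2) by (simp add: finite_fibres_def)
  have "\<forall>x\<in>?S. \<exists>m. x \<in> A m"
    by auto
  then obtain idx where idx: "\<And>x. x \<in> ?S \<Longrightarrow> x \<in> A (idx x)"
    by metis
  show "\<forall>\<^sub>F k in sequentially. (\<Sum>m<k. gf w (A m) $ n) = gf w (\<Union>m. A m) $ n"
  proof (rule eventually_sequentiallyI)
    \<comment> \<open>The element 0 keeps \<open>Max\<close> meaningful when nothing has weight
      \<open>n\<close>.\<close>
    fix k assume k: "Suc (Max (insert 0 (idx ` ?S))) \<le> k"
    have "idx x < k" if "x \<in> ?S" for x
    proof -
      have "idx x \<le> Max (insert 0 (idx ` ?S))"
        using fin that by (intro Max_ge finite.insertI finite_imageI insertI2 imageI)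
      with k show ?thesis
        by linarith
    qed
    with idx have "?S = {x \<in> (\<Union>m<k. A m). w x = n}"
      by blast
    then have "gf w (\<Union>m. A m) $ n = gf w (\<Union>m<k. A m) $ n"
      by (simp add: gf_nth)
    also have "gf w (\<Union>m<k. A m) = (\<Sum>m<k. gf w (A m))"
      using assms by (intro gf_UN_finite)
        (auto simp: disjoint_family_on_def intro: finite_fibres_subset)
    finally show "(\<Sum>m<k. gf w (A m) $ n) = gf w (\<Union>m. A m) $ n"
      by (simp add: fps_sum_nth)
  qed
qed

lemma gf_times:
  assumes "finite_fibres w A" "finite_fibres w' B"
  shows "gf (\<lambda>(x, y). w x + w' y) (A \<times> B) = gf w A * gf w' B"
proof (rule fps_ext)
  fix n
  have "{p \<in> A \<times> B. (case p of (x, y) \<Rightarrow> w x + w' y) = n} =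
      (\<Union>i\<in>{0..n}. {x \<in> A. w x = i} \<times> {y \<in> B. w' y = n - i})"
    by auto
  also have "card \<dots> = (\<Sum>i\<in>{0..n}. card ({x \<in> A. w x = i} \<times> {y \<in> B. w' y = n - i}))"
    using assms by (intro card_UN_disjoint) (auto simp: finite_fibres_def)
  finally show "gf (\<lambda>(x, y). w x + w' y) (A \<times> B) $ n = (gf w A * gf w' B) $ n"
    by (simp add: gf_nth fps_mult_nth card_cartesian_product)
qed

lemma finite_fibres_times:
  assumes "finite_fibres w A" "finite_fibres w' B"
  shows "finite_fibres (\<lambda>(x, y). w x + w' y) (A \<times> B)"
  unfolding finite_fibres_def
proof
  fix n
  have "{p \<in> A \<times> B. (case p of (x, y) \<Rightarrow> w x + w' y) = n} \<subseteq>
      (\<Union>i\<in>{0..n}. {x \<in> A. w x = i} \<times> {y \<in> B. w' y = n - i})"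
    by auto
  then show "finite {p \<in> A \<times> B. (case p of (x, y) \<Rightarrow> w x + w' y) = n}"
    by (rule finite_subset) (use assms in \<open>auto simp: finite_fibres_def\<close>)
qed

section \<open>Partitions with parts in a given set\<close>

text \<open>The two instances are \<open>\<ge>\<close> (repeated parts allowed) and \<open>>\<close> (distinct parts).\<close>

locale part_order =
  fixes R :: "nat \<Rightarrow> nat \<Rightarrow> bool"
  assumes less_imp: "y < x \<Longrightarrow> R x y" and imp_le: "R x y \<Longrightarrow> y \<le> x"
begin

text \<open>If one of the two steps is strict, then \<open>z < x\<close> and \<open>less_imp\<close>
  applies; otherwise \<open>x = y = z\<close> and a hypothesis is the claim.\<close>

lemma R_trans: "R x y \<Longrightarrow> R y z \<Longrightarrow> R x z"
  by (metis less_imp imp_le order.trans le_antisym not_less)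

text \<open>Allowing a set \<open>N\<close> of lengths lets the recurrence \<open>G_insert\<close> serve both for partitions
  without length restriction (\<open>N = UNIV\<close>) and for a fixed number of parts. Removing 0 from \<open>S\<close>
  keeps the number of lists of a given sum finite.\<close>

definition part_lists :: "nat set \<Rightarrow> nat set \<Rightarrow> nat list set" where
  "part_lists S N = {xs. sorted_wrt R xs \<and> set xs \<subseteq> S - {0} \<and> length xs \<in> N}"

definition G :: "nat set \<Rightarrow> nat set \<Rightarrow> rat fps" where
  "G S N = gf sum_list (part_lists S N)"

lemma sorted_imp: "sorted_wrt R xs \<Longrightarrow> sorted_wrt (\<ge>) xs"
  by (erule sorted_wrt_mono_rel[rotated]) (use imp_le in auto)

lemma part_lists_finite_fibres [simp]: "finite_fibres sum_list (part_lists S N)"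
  unfolding finite_fibres_def
proof
  fix n
  have "{xs \<in> part_lists S N. sum_list xs = n} \<subseteq> {lam. is_partition lam n}"
    by (auto simp: part_lists_def is_partition_def sorted_imp)
  then show "finite {xs \<in> part_lists S N. sum_list xs = n}"
    using finite_partitions finite_subset by blast
qed

text \<open>Either the maximal part \<open>m\<close> does not occur, or it stands first and can be
  removed. What remains may contain \<open>m\<close> again exactly when \<open>R m m\<close>, which
  is how the two orders come to differ.\<close>

lemma G_insert:
  assumes "m > 0" "\<And>x. x \<in> S \<Longrightarrow> x < m"
  shows "G (insert m S) N = G S N + fps_X ^ m * G {x \<in> insert m S. R m x} {n. Suc n \<in> N}"
proof -
  let ?T = "part_lists {x \<in> insert m S. R m x} {n. Suc n \<in> N}"
  have "m \<notin> S"
    using assms(2) by blast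
  have "part_lists (insert m S) N = part_lists S N \<union> (#) m ` ?T" (is "?L = ?M")
  proof
    show "?L \<subseteq> ?M"
    proof
      fix xs assume xs: "xs \<in> ?L"
      show "xs \<in> ?M"
      proof (cases "m \<in> set xs")
        case False
        with xs show ?thesis
          by (auto simp: part_lists_def)
      next
        case True
        then obtain y ys where [simp]: "xs = y # ys"
          by (cases xs) auto
        have "y = m"
          using xs True assms(2)[of y] imp_le[of y m] by (fastforce simp: part_lists_def)
        with xs show ?thesis
          by (auto simp: part_lists_def)
      qed
    qed
    show "?M \<subseteq> ?L"
      using assms by (auto simp: part_lists_def)
  qed
  moreover have "part_lists S N \<inter> (#) m ` ?T = {}"
    using \<open>m \<notin> S\<close> by (auto simp: part_lists_def)
  moreover have "gf sum_list ((#) m ` ?T) = gf (\<lambda>xs. m + sum_list xs) ?T"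
    by (rule gf_image) auto
  moreover have "finite_fibres sum_list ((#) m ` ?T)"
    by (rule finite_fibres_subset[OF part_lists_finite_fibres[of "insert m S" N]])
      (simp add: calculation(1))
  ultimately show ?thesis
    by (simp add: G_def gf_Un gf_shift)
qed

text \<open>A descending list consists of its parts in \<open>S\<close> followed by its parts in
  \<open>S'\<close>. Conversely, any two lists can be concatenated, since the strict inequality
  gives \<open>R\<close> across the junction, and filtering by \<open>S\<close> recovers
  both.\<close>

lemma G_append:
  assumes "\<And>x y. x \<in> S \<Longrightarrow> y \<in> S' \<Longrightarrow> y < x"
  shows "G (S \<union> S') UNIV = G S UNIV * G S' UNIV"
proof -
  let ?P = "part_lists S UNIV \<times> part_lists S' UNIV" and ?f = "\<lambda>(xs, ys :: nat list). xs @ ys"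
  have split: "filter (\<lambda>x. x \<in> S) (xs @ ys) = xs \<and> filter (\<lambda>x. x \<notin> S) (xs @ ys) = ys"
    if "(xs, ys) \<in> ?P" for xs ys
  proof -
    have "\<forall>x\<in>set xs. x \<in> S" "\<forall>y\<in>set ys. y \<notin> S"
      using that assms by (auto simp: part_lists_def)
    then show ?thesis
      by (auto simp: filter_empty_conv filter_id_conv)
  qed
  have "inj_on ?f ?P"
  proof (rule inj_onI)
    fix p p' assume "p \<in> ?P" "p' \<in> ?P" "?f p = ?f p'"
    then show "p = p'"
      using split[of "fst p" "snd p"] split[of "fst p'" "snd p'"] by (cases p; cases p') auto
  qed
  moreover have "part_lists (S \<union> S') UNIV = ?f ` ?P"
  proof
    show "?f ` ?P \<subseteq> part_lists (S \<union> S') UNIV"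
    proof
      fix zs assume "zs \<in> ?f ` ?P"
      then obtain xs ys where "zs = xs @ ys" "xs \<in> part_lists S UNIV" "ys \<in> part_lists S' UNIV"
        by auto
      then show "zs \<in> part_lists (S \<union> S') UNIV"
        using assms less_imp by (simp add: part_lists_def sorted_wrt_append subset_iff)
    qed
    show "part_lists (S \<union> S') UNIV \<subseteq> ?f ` ?P"
    proof
      fix xs assume xs: "xs \<in> part_lists (S \<union> S') UNIV"
      \<comment> \<open>No part from \<open>S\<close> can follow a part outside \<open>S\<close>,
        because the list descends and every element of \<open>S\<close> exceeds every element of
        \<open>S'\<close>.\<close>
      have "xs = filter (\<lambda>x. x \<in> S) xs @ filter (\<lambda>x. x \<notin> S) xs"
        using xs
      proof (induction xs)
        case (Cons x xs)
        show ?case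
        proof (cases "x \<in> S")
          case True
          with Cons show ?thesis
            by (auto simp: part_lists_def)
        next
          case False
          then have "y \<notin> S" if "y \<in> set xs" for y
            using Cons.prems that assms imp_le[of x y] by (fastforce simp: part_lists_def)
          with False show ?thesis
            by (auto simp: filter_empty_conv filter_id_conv)
        qed
      qed simp
      moreover have "filter (\<lambda>x. x \<in> S) xs \<in> part_lists S UNIV"
          "filter (\<lambda>x. x \<notin> S) xs \<in> part_lists S' UNIV"
        using xs by (auto simp: part_lists_def sorted_wrt_filter)
      ultimately show "xs \<in> ?f ` ?P"
        by (intro image_eqI[where x = "(filter (\<lambda>x. x \<in> S) xs, filter (\<lambda>x. x \<notin> S) xs)"])
          (auto simp only: prod.case)
    qed
  qed
  ultimately have "G (S \<union> S') UNIV = gf (\<lambda>(xs, ys). sum_list xs + sum_list ys) ?P"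
    unfolding G_def by (simp only:) (rule gf_image, auto)
  then show ?thesis
    by (simp add: gf_times G_def)
qed

lemma G_empty: "G {} N = (if 0 \<in> N then 1 else 0)"
proof -
  have "part_lists {} N = (if 0 \<in> N then {[]} else {})"
    by (auto simp: part_lists_def)
  then show ?thesis
    by (auto simp: G_def gf_def fps_eq_iff Collect_conv_if)
qed

lemma G_zero_length: "G S {0} = 1"
proof -
  have "part_lists S {0} = {[]}"
    by (auto simp: part_lists_def)
  then show ?thesis
    by (auto simp: G_def gf_def fps_eq_iff Collect_conv_if)
qed

text \<open>A nonempty list has sum greater than \<open>n\<close>, so below degree
  \<open>n + 1\<close> only the empty list is counted.\<close>

lemma G_large_parts:
  assumes "\<And>x. x \<in> S \<Longrightarrow> n < x"
  shows "fps_X ^ Suc n dvd G S UNIV - 1"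
proof -
  have "(G S UNIV - 1) $ k = 0" if "k < Suc n" for k
  proof -
    have "{xs \<in> part_lists S UNIV. sum_list xs = k} = (if k = 0 then {[]} else {})"
    proof -
      have "xs = [] \<and> k = 0" if "xs \<in> part_lists S UNIV" "sum_list xs = k" for xs
      proof (cases xs)
        case (Cons y ys)
        then show ?thesis
          using that \<open>k < Suc n\<close> assms[of y] by (auto simp: part_lists_def)
      qed (use that in simp)
      moreover have "[] \<in> part_lists S UNIV"
        by (simp add: part_lists_def)
      ultimately have "xs \<in> part_lists S UNIV \<and> sum_list xs = k \<longleftrightarrow> xs = [] \<and> k = 0" for xs
        by (metis sum_list.Nil)
      then show ?thesis
        by simp
    qed
    then show ?thesis
      by (simp add: G_def gf_nth)
  qed
  then have "G S UNIV - 1 = fps_X ^ Suc n * fps_shift (Suc n) (G S UNIV - 1)"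
    by (auto simp: fps_eq_iff fps_X_power_mult_nth simp del: power_Suc)
  then show ?thesis
    by (metis dvd_triv_left)
qed

end

section \<open>Cutting a partition at a box\<close>

lemma count_hook_numbers:
  "count (hook_numbers lam) h = card {b \<in> ferrers lam. hook_number lam b = h}"
proof -
  have "count (hook_numbers lam) h =
      sum (count (mset_set (ferrers lam))) (hook_number lam -` {h} \<inter> ferrers lam)"
    by (simp add: hook_numbers_def count_image_mset finite_ferrers)
  also have "\<dots> = (\<Sum>b\<in>hook_number lam -` {h} \<inter> ferrers lam. 1)"
    by (rule sum.cong) (auto simp: finite_ferrers)
  also have "\<dots> = card {b \<in> ferrers lam. hook_number lam b = h}"
    by (simp add: vimage_def Int_def conj_commute)
  finally show ?thesis .
qed

text \<open>The box and its arm occupy columns \<open>j\<close> to \<open>s - 1\<close>. With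
  columns counted from 0, a lower row meets column \<open>j\<close> exactly if its length exceeds
  \<open>j\<close>, so the leg consists of the rows in \<open>mid\<close>.\<close>

lemma hook_number_split:
  assumes "j < s" "\<And>x. x \<in> set mid \<Longrightarrow> j < x" "\<And>x. x \<in> set lo \<Longrightarrow> x \<le> j"
  shows "hook_number (hi @ s # mid @ lo) (length hi, j) = s - j + length mid"
proof -
  let ?lam = "hi @ s # mid @ lo" and ?i = "length hi"
  have leg: "i < length ?lam \<and> j < ?lam ! i \<longleftrightarrow> i < Suc ?i + length mid" if i: "?i < i" for i
  proof -
    obtain k where k: "i = Suc ?i + k"
      using less_imp_Suc_add[OF i] by auto
    have "?lam ! i = (mid @ lo) ! k"
      by (simp add: k nth_append)
    moreover have "j < mid ! k" if "k < length mid"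
      using that by (intro assms(2)) simp
    moreover have "lo ! (k - length mid) \<le> j" if "length mid \<le> k" "k < length mid + length lo"
      using that by (intro assms(3) nth_mem) linarith
    ultimately show ?thesis
      by (auto simp: k nth_append not_less[symmetric])
  qed
  have "hook ?lam (?i, j) = Pair ?i ` {j..<s} \<union> (\<lambda>i. (i, j)) ` {Suc ?i..<Suc ?i + length mid}"
      (is "?L = ?A \<union> ?B")
  proof (intro set_eqI)
    fix b :: "nat \<times> nat"
    obtain i' j' where b: "b = (i', j')"
      by (cases b)
    consider "i' < ?i" | "i' = ?i" | "?i < i'"
      by linarith
    then show "b \<in> ?L \<longleftrightarrow> b \<in> ?A \<union> ?B"
    proof cases
      case 3
      then show ?thesis
        using leg[OF 3] by (auto simp: b hook_def ferrers_def)
    qed (use assms(1) in \<open>auto simp: b hook_def ferrers_def\<close>)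
  qed
  moreover have "card (?A \<union> ?B) = card ?A + card ?B"
    by (rule card_Un_disjoint) auto
  moreover have "card ?A = s - j" "card ?B = length mid"
    by (subst card_image; auto intro: inj_onI)+
  ultimately show ?thesis
    by (simp add: hook_number_def)
qed

section \<open>Marked boxes and the three lists around them\<close>

context part_order
begin

text \<open>Pairing each partition with a marked box turns the multiplicity of \<open>h\<close>
  among the hook numbers into a cardinality.\<close>

definition hook_boxes :: "nat set \<Rightarrow> nat \<Rightarrow> (nat list \<times> nat \<times> nat) set" where
  "hook_boxes P h =
    {(lam, b). lam \<in> part_lists P UNIV \<and> b \<in> ferrers lam \<and> hook_number lam b = h}"

lemma finite_fibres_hook_boxes: "finite_fibres (\<lambda>x. sum_list (fst x)) (hook_boxes P h)"
  unfolding finite_fibres_def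
proof
  fix n
  have "{x \<in> hook_boxes P h. sum_list (fst x) = n} \<subseteq>
      (SIGMA lam:{lam \<in> part_lists P UNIV. sum_list lam = n}. ferrers lam)"
    by (auto simp: hook_boxes_def)
  then show "finite {x \<in> hook_boxes P h. sum_list (fst x) = n}"
    by (rule finite_subset)
      (use part_lists_finite_fibres in \<open>simp add: finite_fibres_def finite_ferrers\<close>)
qed

lemma gf_hook_boxes:
  "gf (\<lambda>x. sum_list (fst x)) (hook_boxes P h) = Abs_fps (\<lambda>n. of_nat
    (\<Sum>lam\<in>{lam \<in> part_lists P UNIV. sum_list lam = n}. count (hook_numbers lam) h))"
proof (rule fps_ext)
  fix n
  let ?A = "{lam \<in> part_lists P UNIV. sum_list lam = n}"
  have "{x \<in> hook_boxes P h. sum_list (fst x) = n} =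
      (SIGMA lam:?A. {b \<in> ferrers lam. hook_number lam b = h})"
    by (auto simp: hook_boxes_def)
  also have "card \<dots> = (\<Sum>lam\<in>?A. card {b \<in> ferrers lam. hook_number lam b = h})"
    using part_lists_finite_fibres[of P UNIV]
    by (intro card_SigmaI) (auto simp: finite_fibres_def finite_ferrers)
  finally show "gf (\<lambda>x. sum_list (fst x)) (hook_boxes P h) $ n =
      Abs_fps (\<lambda>n. of_nat (\<Sum>lam\<in>{lam \<in> part_lists P UNIV. sum_list lam = n}.
        count (hook_numbers lam) h)) $ n"
    by (simp add: gf_nth count_hook_numbers)
qed

definition assemble :: "nat \<Rightarrow> nat \<Rightarrow> nat list \<times> nat list \<times> nat list \<Rightarrow> nat list \<times> nat \<times> nat" where
  "assemble j s = (\<lambda>(hi, mid, lo). (hi @ s # mid @ lo, length hi, j))"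

text \<open>Each list is constrained by \<open>s\<close> and \<open>j\<close> only, never by the
  other two, so this is a product set. With repeated parts, further copies of \<open>s\<close> may
  occur in \<open>hi\<close> and in \<open>mid\<close>; with distinct parts \<open>R\<close>
  excludes them.\<close>

definition pieces :: "nat set \<Rightarrow> nat \<Rightarrow> nat \<Rightarrow> nat \<Rightarrow> (nat list \<times> nat list \<times> nat list) set" where
  "pieces P j s l = part_lists {p \<in> P. R p s} UNIV \<times>
    part_lists {p \<in> P. R s p \<and> j < p} {l} \<times> part_lists {p \<in> P. p \<le> j} UNIV"

text \<open>The marked box records the length of \<open>hi\<close>, and the length of
  \<open>mid\<close> is fixed at \<open>l\<close>, so the concatenation can be cut again in only one
  way.\<close>

lemma inj_on_assemble: "inj_on (assemble j s) (pieces P j s l)"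
proof (rule inj_onI)
  fix x y assume x: "x \<in> pieces P j s l" and y: "y \<in> pieces P j s l"
    and eq: "assemble j s x = assemble j s y"
  obtain hi mid lo hi' mid' lo' where xy: "x = (hi, mid, lo)" "y = (hi', mid', lo')"
    by (cases x; cases y)
  have "length mid = length mid'"
    using x y by (simp add: xy pieces_def part_lists_def)
  with eq show "x = y"
    by (auto simp: xy assemble_def)
qed

lemma gf_assemble:
  "gf (\<lambda>x. sum_list (fst x)) (assemble j s ` pieces P j s l) = fps_X ^ s *
    (G {p \<in> P. R p s} UNIV * (G {p \<in> P. R s p \<and> j < p} {l} * G {p \<in> P. p \<le> j} UNIV))"
proof -
  have "gf (\<lambda>x. sum_list (fst x)) (assemble j s ` pieces P j s l) =
      gf (\<lambda>x. s + (case x of (hi, y) \<Rightarrow>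
        sum_list hi + (case y of (mid, lo) \<Rightarrow> sum_list mid + sum_list lo))) (pieces P j s l)"
    by (rule gf_image[OF inj_on_assemble]) (auto simp: assemble_def)
  then show ?thesis
    by (simp add: gf_shift pieces_def gf_times finite_fibres_times G_def)
qed

lemma dropWhile_le: "sorted_wrt R xs \<Longrightarrow> x \<in> set (dropWhile (\<lambda>x. j < x) xs) \<Longrightarrow> x \<le> j"
  by (induction xs) (auto split: if_splits dest!: imp_le bspec)

text \<open>The order conditions of \<open>pieces\<close> make neighbouring blocks comparable, with
  \<open>j\<close> separating \<open>mid\<close> from \<open>lo\<close>; transitivity through
  \<open>s\<close> handles \<open>hi\<close>.\<close>

lemma assemble_pieces_subset:
  assumes "j < s" "s \<in> P"
  shows "assemble j s ` pieces P j s l \<subseteq> hook_boxes P (s - j + l)"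
proof
  fix x assume "x \<in> assemble j s ` pieces P j s l"
  then obtain hi mid lo where x: "x = (hi @ s # mid @ lo, length hi, j)"
    and hi: "hi \<in> part_lists {p \<in> P. R p s} UNIV"
    and mid: "mid \<in> part_lists {p \<in> P. R s p \<and> j < p} {l}"
    and lo: "lo \<in> part_lists {p \<in> P. p \<le> j} UNIV"
    by (auto simp: assemble_def pieces_def)
  have "R s p" if "p \<in> set lo" for p
    using that lo assms(1) by (intro less_imp) (auto simp: part_lists_def)
  moreover have "R m p" if "m \<in> set mid" "p \<in> set lo" for m p
    using that lo mid by (intro less_imp) (auto simp: part_lists_def intro: le_less_trans)
  moreover have "R s m" if "m \<in> set mid" for m
    using that mid by (auto simp: part_lists_def)
  moreover have hs: "R p s" if "p \<in> set hi" for p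
    using that hi by (auto simp: part_lists_def)
  ultimately have "sorted_wrt R (hi @ s # mid @ lo)"
    using hi mid lo by (auto simp: sorted_wrt_append part_lists_def intro: R_trans[OF hs])
  moreover have "set (hi @ s # mid @ lo) \<subseteq> P - {0}"
    using hi mid lo assms by (auto simp: part_lists_def)
  moreover have "hook_number (hi @ s # mid @ lo) (length hi, j) = s - j + l"
    using hook_number_split[of j s mid lo hi] assms mid lo by (auto simp: part_lists_def)
  ultimately show "x \<in> hook_boxes P (s - j + l)"
    using assms by (simp add: x hook_boxes_def part_lists_def ferrers_def)
qed

text \<open>The row of the box gives \<open>s\<close>. The rows below it descend, so those longer
  than \<open>j\<close> form an initial block, which is taken as \<open>mid\<close>.\<close>

lemma hook_boxes_subset:
  assumes "x \<in> hook_boxes P h"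
  shows "\<exists>l<h. \<exists>j. j + (h - l) \<in> P \<and> x \<in> assemble j (j + (h - l)) ` pieces P j (j + (h - l)) l"
proof -
  obtain lam i j where x: "x = (lam, i, j)"
    by (cases x)
  have lam: "lam \<in> part_lists P UNIV" and ij: "i < length lam" "j < lam ! i"
    and h: "hook_number lam (i, j) = h"
    using assms by (auto simp: x hook_boxes_def ferrers_def)
  define s rest where "s = lam ! i" and "rest = drop (Suc i) lam"
  define hi mid lo where "hi = take i lam" and "mid = takeWhile (\<lambda>x. j < x) rest"
    and "lo = dropWhile (\<lambda>x. j < x) rest"
  have split: "lam = hi @ s # mid @ lo"
    using ij by (simp add: hi_def s_def mid_def lo_def rest_def id_take_nth_drop)
  have sorted: "sorted_wrt R (hi @ s # mid @ lo)" and parts: "set (hi @ s # mid @ lo) \<subseteq> P - {0}"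
    using lam by (auto simp: split[symmetric] part_lists_def)
  have "length hi = i"
    using ij by (simp add: hi_def)
  have mid: "j < p" if "p \<in> set mid" for p
    using that by (auto simp: mid_def dest: set_takeWhileD)
  have "sorted_wrt R rest"
    using lam by (simp add: rest_def part_lists_def sorted_wrt_drop)
  then have lo: "p \<le> j" if "p \<in> set lo" for p
    using that dropWhile_le by (auto simp: lo_def)
  have "hook_number (hi @ s # mid @ lo) (length hi, j) = s - j + length mid"
    by (rule hook_number_split) (use ij mid lo in \<open>simp_all add: s_def\<close>)
  then have "hook_number lam (i, j) = s - j + length mid"
    unfolding split[symmetric] \<open>length hi = i\<close> .
  \<comment> \<open>The box lies in its row, so \<open>j < s\<close>; hence the leg is shorter than
    the hook number, and \<open>s\<close> is determined by \<open>j\<close> and the leg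
    length.\<close>
  with h ij have l: "length mid < h" "s = j + (h - length mid)"
    by (auto simp: s_def)
  have "(hi, mid, lo) \<in> pieces P j s (length mid)"
    using sorted parts mid lo by (auto simp: pieces_def part_lists_def sorted_wrt_append)
  moreover have "x = assemble j s (hi, mid, lo)"
    by (simp add: x assemble_def split \<open>length hi = i\<close>)
  moreover have "s \<in> P"
    using parts by simp
  ultimately show ?thesis
    using l by blast
qed

lemma hook_boxes_eq:
  "hook_boxes P h =
    (\<Union>l<h. \<Union>j\<in>{j. j + (h - l) \<in> P}. assemble j (j + (h - l)) ` pieces P j (j + (h - l)) l)"
    (is "_ = ?U")
proof
  show "hook_boxes P h \<subseteq> ?U"
    using hook_boxes_subset by fastforce
  show "?U \<subseteq> hook_boxes P h"
  proof (intro UN_least)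
    fix l j assume "l \<in> {..<h}" "j \<in> {j. j + (h - l) \<in> P}"
    then show "assemble j (j + (h - l)) ` pieces P j (j + (h - l)) l \<subseteq> hook_boxes P h"
      using assemble_pieces_subset[of j "j + (h - l)" P l] by simp
  qed
qed

text \<open>The map \<open>r l\<close> enumerates the columns admissible for leg length
  \<open>l\<close>. This leaves room for the odd case, where these columns have a fixed parity and
  the sum over \<open>m\<close> must skip the others.\<close>

lemma gf_hook_boxes_sum:
  assumes inj: "\<And>l. l < h \<Longrightarrow> inj (r l)"
    and range: "\<And>l. l < h \<Longrightarrow> range (r l) = {j. j + (h - l) \<in> P}"
    and F: "\<And>l m. l < h \<Longrightarrow> F l m = (let j = r l m; s = j + (h - l) in fps_X ^ s *
      (G {p \<in> P. R p s} UNIV * (G {p \<in> P. R s p \<and> j < p} {l} * G {p \<in> P. p \<le> j} UNIV)))"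
  shows "gf (\<lambda>x. sum_list (fst x)) (hook_boxes P h) = (\<Sum>l<h. \<Sum>m. F l m)"
proof -
  let ?w = "\<lambda>x :: nat list \<times> nat \<times> nat. sum_list (fst x)"
  define B where "B l j = assemble j (j + (h - l)) ` pieces P j (j + (h - l)) l" for l j
  define U where "U l = (\<Union>j\<in>{j. j + (h - l) \<in> P}. B l j)" for l
  \<comment> \<open>The box reveals \<open>j\<close>, and its row length then reveals
    \<open>h - l\<close>, hence \<open>l\<close> as long as \<open>l < h\<close>. All disjointness
    claims rest on this.\<close>
  have mem: "snd (snd x) = j \<and> fst x ! fst (snd x) = j + (h - l)" if "x \<in> B l j" for x l j
    using that by (auto simp: B_def assemble_def)
  have eq: "hook_boxes P h = (\<Union>l<h. U l)"
    by (simp add: hook_boxes_eq U_def B_def)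
  have fin: "finite_fibres ?w (U l)" if "l < h" for l
    by (rule finite_fibres_subset[OF finite_fibres_hook_boxes[of P h]]) (use that eq in auto)
  have "disjoint_family_on U {..<h}"
    unfolding disjoint_family_on_def
  proof (intro ballI impI)
    fix l l' assume l: "l \<in> {..<h}" "l' \<in> {..<h}" "l \<noteq> l'"
    show "U l \<inter> U l' = {}"
    proof (rule ccontr)
      assume "U l \<inter> U l' \<noteq> {}"
      then obtain x j j' where "x \<in> B l j" "x \<in> B l' j'"
        by (auto simp: U_def)
      from mem[OF this(1)] mem[OF this(2)] l show False
        by auto
    qed
  qed
  then have "gf ?w (hook_boxes P h) = (\<Sum>l<h. gf ?w (U l))"
    unfolding eq by (intro gf_UN_finite) (use fin in auto)
  also have "\<dots> = (\<Sum>l<h. \<Sum>m. F l m)"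
  proof (rule sum.cong)
    fix l assume "l \<in> {..<h}"
    then have l: "l < h"
      by simp
    have Ul: "U l = (\<Union>m. B l (r l m))"
      by (simp add: U_def range[OF l, symmetric])
    have "disjoint_family (\<lambda>m. B l (r l m))"
      unfolding disjoint_family_on_def
    proof (intro ballI impI)
      fix m m' :: nat assume "m \<noteq> m'"
      then have "r l m \<noteq> r l m'"
        using inj[OF l] by (auto dest: injD)
      then show "B l (r l m) \<inter> B l (r l m') = {}"
        using mem[of _ l "r l m"] mem[of _ l "r l m'"] by fastforce
    qed
    then have "(\<lambda>m. gf ?w (B l (r l m))) sums gf ?w (U l)"
      unfolding Ul by (rule gf_UN_sums) (use fin[OF l] Ul in simp)
    moreover have "gf ?w (B l (r l m)) = F l m" for m
      unfolding B_def gf_assemble by (simp add: F[OF l] Let_def)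
    ultimately show "gf ?w (U l) = (\<Sum>m. F l m)"
      by (simp add: sums_iff)
  qed simp
  finally show ?thesis .
qed

end

section \<open>Parts in an arithmetic progression\<close>

lemma qpoch_unit: "d > 0 \<Longrightarrow> e > 0 \<Longrightarrow> qpoch (fps_X ^ d) (fps_X ^ e) n $ 0 = 1"
  by (induction n) (simp_all add: qpoch_def)

lemma qpoch_neg_unit: "d > 0 \<Longrightarrow> e > 0 \<Longrightarrow> qpoch (- (fps_X ^ d)) (fps_X ^ e) n $ 0 = 1"
  by (induction n) (simp_all add: qpoch_def)

lemma qpoch_0 [simp]: "qpoch x q 0 = 1"
  by (simp add: qpoch_def)

lemma qpoch_Suc: "qpoch q q (Suc n) = qpoch q q n * (1 - q ^ Suc n)"
  by (simp add: qpoch_def)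

text \<open>Allows evaluations by q-binomials to be proved by induction without any
  division.\<close>

lemma eq_mult_qbinomI:
  assumes "d > 0"
    and "W * qpoch (fps_X ^ d) (fps_X ^ d) l * qpoch (fps_X ^ d) (fps_X ^ d) k =
      E * qpoch (fps_X ^ d) (fps_X ^ d) (l + k)"
  shows "W = E * qbinom (fps_X ^ d) (l + k) k"
proof -
  let ?P = "qpoch (fps_X ^ d) (fps_X ^ d)"
  have unit: "(?P k * ?P l) $ 0 \<noteq> 0"
    using assms(1) by (simp add: qpoch_unit)
  have "W = W * ?P l * ?P k * inverse (?P k * ?P l)"
    using inverse_mult_eq_1[OF unit] by (simp add: algebra_simps)
  then show ?thesis
    unfolding assms(2) using unit by (simp add: qbinom_def fps_divide_unit mult.assoc)
qed

text \<open>One step of the \<open>q\<close>-Pascal rule, with all denominators cleared.\<close>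

lemma pascal_step:
  fixes a b :: "'a :: comm_ring_1"
  assumes "W * (p * (1 - a)) * r = E' * s" "W' * p * (r * (1 - b)) = E * s" "y * E = E' * b"
  shows "(W + y * W') * (p * (1 - a)) * (r * (1 - b)) = E' * (s * (1 - a * b))"
proof -
  have "(W + y * W') * (p * (1 - a)) * (r * (1 - b)) =
      (W * (p * (1 - a)) * r) * (1 - b) + y * (W' * p * (r * (1 - b))) * (1 - a)"
    by (simp add: algebra_simps)
  also have "\<dots> = E' * s * (1 - b) + (y * E) * s * (1 - a)"
    unfolding assms(1,2) by (simp add: algebra_simps)
  also have "\<dots> = E' * (s * (1 - a * b))"
    unfolding assms(3) by (simp add: algebra_simps)
  finally show ?thesis .
qed

text \<open>Serves the case \<open>k = 0\<close> of the inductions below, where only one summand of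
  the recurrence survives.\<close>

lemma mult_eq_extend:
  fixes y :: "'a :: comm_ring_1"
  assumes "W * p * r = E * s"
  shows "y * W * (p * z) * r = y * E * (s * z)"
proof -
  have "y * W * (p * z) * r = y * (W * p * r) * z"
    by (simp add: mult_ac)
  then show ?thesis
    unfolding assms by (simp add: mult_ac)
qed

section \<open>Recurrences and closed forms for arithmetic progressions\<close>

definition progression :: "nat \<Rightarrow> nat \<Rightarrow> nat \<Rightarrow> nat set" where
  "progression c d k = (\<lambda>i. c + d * i) ` {..<k}"

lemma progression_0 [simp]: "progression c d 0 = {}"
  by (simp add: progression_def)

lemma progression_Suc: "progression c d (Suc k) = insert (c + d * k) (progression c d k)"
  by (simp add: progression_def lessThan_Suc)

lemma progression_less: "d > 0 \<Longrightarrow> x \<in> progression c d k \<Longrightarrow> x < c + d * k"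
  by (auto simp: progression_def)

interpretation multi: part_order "(\<ge>)"
  by unfold_locales auto

interpretation strict: part_order "(>)"
  by unfold_locales auto

context
  fixes c d :: nat
  assumes pos: "c > 0" "d > 0"
begin

lemma multi_G_progression_Suc:
  "multi.G (progression c d (Suc k)) N = multi.G (progression c d k) N +
    fps_X ^ (c + d * k) * multi.G (progression c d (Suc k)) {n. Suc n \<in> N}"
proof -
  have "{x \<in> progression c d (Suc k). c + d * k \<ge> x} = progression c d (Suc k)"
    using progression_less[OF pos(2), of _ c k] by (auto simp: progression_Suc less_imp_le)
  then show ?thesis
    using multi.G_insert[of "c + d * k" "progression c d k" N] progression_less[OF pos(2)] pos
    by (simp add: progression_Suc)
qed

lemma strict_G_progression_Suc:
  "strict.G (progression c d (Suc k)) N = strict.G (progression c d k) N +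
    fps_X ^ (c + d * k) * strict.G (progression c d k) {n. Suc n \<in> N}"
proof -
  have "{x \<in> progression c d (Suc k). c + d * k > x} = progression c d k"
    using progression_less[OF pos(2), of _ c k] by (auto simp: progression_Suc)
  then show ?thesis
    using strict.G_insert[of "c + d * k" "progression c d k" N] progression_less[OF pos(2)] pos
    by (simp add: progression_Suc)
qed

text \<open>The recurrence has the same series on both sides when \<open>N = UNIV\<close>; solving
  for it splits off the factor \<open>1 - fps_X ^ (c + d * k)\<close>.\<close>

lemma multi_G_progression:
  "multi.G (progression c d k) UNIV * qpoch (fps_X ^ c) (fps_X ^ d) k = 1"
proof (induction k)
  case 0
  show ?case
    by (simp add: multi.G_empty qpoch_def)
next
  case (Suc k)
  have "multi.G (progression c d (Suc k)) UNIV * qpoch (fps_X ^ c) (fps_X ^ d) (Suc k) =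
      multi.G (progression c d (Suc k)) UNIV * (1 - fps_X ^ (c + d * k)) *
        qpoch (fps_X ^ c) (fps_X ^ d) k"
    by (simp add: qpoch_def power_add power_mult mult_ac)
  moreover have "multi.G (progression c d (Suc k)) UNIV * (1 - fps_X ^ (c + d * k)) =
      multi.G (progression c d k) UNIV"
    using multi_G_progression_Suc[of k UNIV] by (simp add: algebra_simps)
  ultimately show ?case
    using Suc by simp
qed

lemma strict_G_progression:
  "strict.G (progression c d k) UNIV = qpoch (- (fps_X ^ c)) (fps_X ^ d) k"
proof (induction k)
  case 0
  show ?case
    by (simp add: strict.G_empty qpoch_def)
next
  case (Suc k)
  then show ?case
    using strict_G_progression_Suc[of k UNIV]
    by (simp add: qpoch_def power_add power_mult algebra_simps)
qed

text \<open>Subtracting \<open>c\<close> from each of the \<open>l\<close> parts and dividing by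
  \<open>d\<close> leaves a partition inside an \<open>l\<close> by \<open>k\<close> rectangle,
  counted by the Gaussian binomial. The proof is by the recurrence, with an outer induction on
  \<open>l\<close> and an inner one on \<open>k\<close>.\<close>

lemma multi_G_progression_length:
  "multi.G (progression c d (Suc k)) {l} = fps_X ^ (c * l) * qbinom (fps_X ^ d) (l + k) k"
proof (rule eq_mult_qbinomI)
  let ?P = "qpoch (fps_X ^ d) (fps_X ^ d)"
  show "multi.G (progression c d (Suc k)) {l} * ?P l * ?P k = fps_X ^ (c * l) * ?P (l + k)"
  proof (induction l arbitrary: k)
    case 0
    show ?case
      by (simp add: multi.G_zero_length qpoch_def)
  next
    case (Suc l)
    note IH = Suc
    have length: "{n. Suc n \<in> {Suc l}} = {l}"
      by auto
    show ?case
    proof (induction k)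
      case 0
      show ?case
        unfolding multi_G_progression_Suc[of _ "{Suc l}"] length
        using mult_eq_extend[OF IH[of 0], of "fps_X ^ c" "1 - (fps_X ^ d) ^ Suc l"]
        by (simp add: multi.G_empty qpoch_Suc power_add mult_ac)
    next
      case (Suc k)
      \<comment> \<open>This is the product \<open>a * b\<close> of \<open>pascal_step\<close>, with
        \<open>a\<close> and \<open>b\<close> the last powers in the two shorter Pochhammer
        symbols.\<close>
      have "(fps_X ^ d) ^ Suc (Suc l + k) = (fps_X ^ d) ^ Suc l * (fps_X ^ d :: rat fps) ^ Suc k"
        by (simp flip: power_add)
      then show ?case
        unfolding multi_G_progression_Suc[of "Suc k" "{Suc l}"] length add_Suc_right qpoch_Suc
          qpoch_Suc[of _ "Suc l + k"]
        using Suc IH[of "Suc k"]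
        by (simp only:, intro pascal_step[where E = "fps_X ^ (c * l)"])
          (simp_all add: qpoch_Suc power_add power_mult mult_ac)
    qed
  qed
qed (fact pos)

lemma strict_G_progression_length_0: "k < l \<Longrightarrow> strict.G (progression c d k) {l} = 0"
proof (induction k arbitrary: l)
  case 0
  then show ?case
    by (simp add: strict.G_empty)
next
  case (Suc k)
  then obtain l' where [simp]: "l = Suc l'"
    by (cases l) auto
  have "{n. Suc n \<in> {Suc l'}} = {l'}"
    by auto
  with Suc show ?case
    by (simp add: strict_G_progression_Suc)
qed

text \<open>The \<open>l\<close> smallest terms have sum
  \<open>c * l + d * (l * (l - 1) div 2)\<close>. Subtracting them from the parts in increasing
  order leaves, up to the scale \<open>d\<close>, a partition inside an \<open>l\<close> by
  \<open>k\<close> rectangle.\<close>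

lemma strict_G_progression_length:
  "strict.G (progression c d (l + k)) {l} =
    fps_X ^ (c * l + d * (l * (l - 1) div 2)) * qbinom (fps_X ^ d) (l + k) k"
proof (rule eq_mult_qbinomI)
  let ?P = "qpoch (fps_X ^ d) (fps_X ^ d)" and ?e = "\<lambda>l. c * l + d * (l * (l - 1) div 2)"
  have step: "?e (Suc l) = c + d * l + ?e l" for l
  proof -
    have "Suc l * (Suc l - 1) = l * (l - 1) + 2 * l"
      by (cases l) simp_all
    then have "Suc l * (Suc l - 1) div 2 = l * (l - 1) div 2 + l"
      by simp
    then show ?thesis
      by (simp only: algebra_simps mult_Suc_right)
  qed
  show "strict.G (progression c d (l + k)) {l} * ?P l * ?P k = fps_X ^ ?e l * ?P (l + k)"
  proof (induction l arbitrary: k)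
    case 0
    show ?case
      by (simp add: strict.G_zero_length qpoch_def)
  next
    case (Suc l)
    note IH = Suc
    have length: "{n. Suc n \<in> {Suc l}} = {l}"
      by auto
    show ?case
    proof (induction k)
      case 0
      have "strict.G (progression c d (Suc l + 0)) {Suc l} =
          fps_X ^ (c + d * l) * strict.G (progression c d (l + 0)) {l}"
        by (simp add: strict_G_progression_Suc length strict_G_progression_length_0)
      then show ?case
        unfolding step
        using mult_eq_extend[OF IH[of 0], of "fps_X ^ (c + d * l)" "1 - (fps_X ^ d) ^ Suc l"]
        by (simp add: qpoch_Suc power_add mult_ac)
    next
      case (Suc k)
      have "(fps_X ^ d) ^ Suc (Suc l + k) = (fps_X ^ d) ^ Suc l * (fps_X ^ d :: rat fps) ^ Suc k"
        by (simp flip: power_add)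
      \<comment> \<open>The premise \<open>y * E = E' * b\<close> of
        \<open>pascal_step\<close>.\<close>
      moreover have "fps_X ^ (c + d * (Suc l + k)) * fps_X ^ ?e l =
          fps_X ^ ?e (Suc l) * (fps_X ^ d :: rat fps) ^ Suc k"
        unfolding step by (simp add: power_add power_mult mult_ac)
      ultimately show ?case
        unfolding strict_G_progression_Suc[of "Suc l + k" "{Suc l}"] length add_Suc_right qpoch_Suc
          qpoch_Suc[of _ "Suc l + k"]
        using Suc IH[of "Suc k"]
        by (simp only:, intro pascal_step[where E = "fps_X ^ ?e l"])
          (simp_all add: qpoch_Suc)
    qed
  qed
qed (fact pos)

end

section \<open>Euler's theorem\<close>

lemma progression_1: "progression c (Suc 0) k = {c..<c + k}"
  by (simp add: progression_def lessThan_atLeast0 add.commute[of c])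

lemma progression_2: "odd c \<Longrightarrow> progression c 2 k = {p. odd p \<and> c \<le> p \<and> p < c + 2 * k}"
proof (intro set_eqI iffI)
  fix p assume "odd c" "p \<in> {p. odd p \<and> c \<le> p \<and> p < c + 2 * k}"
  then have "even (p - c)" "c \<le> p" "p < c + 2 * k"
    by auto
  moreover from this(1) obtain i where "p - c = 2 * i"
    by (rule evenE)
  ultimately have "p = c + 2 * i" "i < k"
    by linarith+
  then show "p \<in> progression c 2 k"
    by (auto simp: progression_def)
qed (auto simp: progression_def)

lemma qpoch_inf_eq:
  assumes "\<And>n. fps_X ^ Suc n dvd qpoch x q n - s"
  shows "qpoch_inf x q = s"
  unfolding qpoch_inf_def by (rule limI[OF fps_tendsto_power_dvd[OF assms]])

text \<open>Parts up to \<open>n\<close> give the finite product, and parts above \<open>n\<close>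
  contribute a factor congruent to 1 modulo \<open>fps_X ^ Suc n\<close>.\<close>

lemma strict_G_positive: "strict.G {0<..} UNIV = qpoch_inf (- fps_X) fps_X"
proof (rule qpoch_inf_eq[symmetric])
  fix n
  have "{0<..} = {n<..} \<union> progression 1 1 n"
    by (auto simp: progression_1)
  then have "strict.G {0<..} UNIV = strict.G {n<..} UNIV * strict.G (progression 1 1 n) UNIV"
    by (simp only:, intro strict.G_append) (auto simp: progression_1)
  moreover have "strict.G (progression 1 1 n) UNIV = qpoch (- fps_X) fps_X n"
    using strict_G_progression[of 1 1 n] by simp
  ultimately have "qpoch (- fps_X) fps_X n - strict.G {0<..} UNIV =
      (strict.G {n<..} UNIV - 1) * - qpoch (- fps_X) fps_X n"
    by (simp add: algebra_simps)
  moreover have "fps_X ^ Suc n dvd strict.G {n<..} UNIV - 1"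
    by (rule strict.G_large_parts) simp
  ultimately show "fps_X ^ Suc n dvd qpoch (- fps_X) fps_X n - strict.G {0<..} UNIV"
    by (simp only: dvd_mult2)
qed

lemma qpoch_add: "qpoch x q (m + n) = qpoch x q m * qpoch (x * q ^ m) q n"
  by (induction n) (simp_all add: qpoch_def power_add mult_ac)

lemma qpoch_dvd: "y dvd x \<Longrightarrow> y dvd qpoch x q n - 1"
proof (induction n)
  case (Suc n)
  have "qpoch x q (Suc n) - 1 = (qpoch x q n - 1) - x * (q ^ n * qpoch x q n)"
    by (simp add: qpoch_def algebra_simps)
  with Suc show ?case
    by (simp only: dvd_diff dvd_mult2)
qed simp

text \<open>A finite form of Euler's identity: (-q;q)_n (q;q)_n = (q^2;q^2)_n supplies the even
  factors of (q;q)_2n, and (q;q^2)_n the odd ones.\<close>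

lemma qpoch_double:
  "qpoch q (q\<^sup>2) n * qpoch (- q) q n * qpoch q q n = qpoch q q (2 * n)"
proof (induction n)
  case (Suc n)
  have "qpoch q (q\<^sup>2) (Suc n) * qpoch (- q) q (Suc n) * qpoch q q (Suc n) =
      (qpoch q (q\<^sup>2) n * qpoch (- q) q n * qpoch q q n) *
      ((1 - q ^ Suc (2 * n)) * ((1 + q ^ Suc n) * (1 - q ^ Suc n)))"
    by (simp add: qpoch_def mult_ac flip: power_mult)
  also have "(1 + q ^ Suc n) * (1 - q ^ Suc n) = 1 - q ^ Suc (Suc (2 * n))"
    by (simp add: algebra_simps flip: power_add power_Suc mult_2)
  also have "qpoch q (q\<^sup>2) n * qpoch (- q) q n * qpoch q q n *
      ((1 - q ^ Suc (2 * n)) * (1 - q ^ Suc (Suc (2 * n)))) = qpoch q q (2 * Suc n)"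
    unfolding Suc by (simp add: qpoch_Suc mult.assoc del: power_Suc)
  finally show ?case .
qed simp

lemma multi_G_odd: "multi.G {p. odd p} UNIV = qpoch_inf (- fps_X) fps_X"
proof (rule qpoch_inf_eq[symmetric])
  fix n
  let ?X = "fps_X :: rat fps"
  define T where "T = multi.G {p. odd p \<and> 1 + 2 * n \<le> p} UNIV"
  define O' where "O' = qpoch ?X (?X\<^sup>2) n"
  define D where "D = qpoch (- ?X) ?X n"
  define U where "U = qpoch (?X * ?X ^ n) ?X n"
  let ?G = "multi.G {p. odd p} UNIV"
  have "{p. odd p} = {p. odd p \<and> 1 + 2 * n \<le> p} \<union> progression 1 2 n"
    by (auto simp: progression_2 odd_pos Suc_le_eq)
  then have "?G = T * multi.G (progression 1 2 n) UNIV"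
    unfolding T_def by (simp only:, intro multi.G_append) (auto simp: progression_2)
  moreover have "multi.G (progression 1 2 n) UNIV * O' = 1"
    using multi_G_progression[of 1 2 n] by (simp add: O'_def)
  ultimately have GO: "?G * O' = T"
    by (simp add: mult.assoc)
  \<comment> \<open>Both sides are (q;q)_2n; cancelling (q;q)_n leaves
    \<open>O' * D = U\<close>.\<close>
  have "O' * D * qpoch ?X ?X n = qpoch ?X ?X n * U"
    unfolding O'_def D_def U_def qpoch_double by (simp add: mult_2 qpoch_add)
  moreover have "qpoch ?X ?X n \<noteq> 0"
    using qpoch_unit[of 1 1 n] by auto
  ultimately have "O' * D = U"
    by (simp add: mult.commute)
  then have "?G * U = ?G * O' * D"
    by (simp only: mult.assoc)
  then have "?G * U = T * D"
    unfolding GO .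
  \<comment> \<open>As \<open>U\<close> and \<open>T\<close> are congruent to 1 modulo
    \<open>fps_X ^ Suc n\<close>, the equation \<open>?G * U = T * D\<close> makes \<open>?G\<close>
    and \<open>D\<close> congruent.\<close>
  then have "D - ?G = (U - 1) * ?G - (T - 1) * D"
    by (simp add: algebra_simps)
  moreover have "fps_X ^ Suc n dvd U - 1"
    unfolding U_def by (rule qpoch_dvd) simp
  moreover have "fps_X ^ Suc n dvd T - 1"
    unfolding T_def by (rule multi.G_large_parts) auto
  ultimately show "fps_X ^ Suc n dvd qpoch (- ?X) ?X n - ?G"
    by (simp add: D_def[symmetric] dvd_diff dvd_mult2 del: power_Suc)
qed

section \<open>Summation over all boxes with a given hook number\<close>

lemma odd_partitions_eq:
  "odd_partitions n = {lam \<in> multi.part_lists {p. odd p} UNIV. sum_list lam = n}"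
  by (auto simp: odd_partitions_def is_partition_def multi.part_lists_def intro: odd_pos)

lemma distinct_partitions_eq:
  "distinct_partitions n = {lam \<in> strict.part_lists {0<..} UNIV. sum_list lam = n}"
proof -
  have "sorted_wrt (\<ge>) xs \<and> distinct xs \<longleftrightarrow> sorted_wrt (>) xs" for xs :: "nat list"
    by (induction xs) (auto simp: less_le)
  then show ?thesis
    by (auto simp: distinct_partitions_def is_partition_def strict.part_lists_def)
qed

lemma a_gf_eq: "a_gf h = gf (\<lambda>x. sum_list (fst x)) (multi.hook_boxes {p. odd p} h)"
  by (simp add: a_gf_def a_hook_def multi.gf_hook_boxes odd_partitions_eq)

lemma b_gf_eq: "b_gf h = gf (\<lambda>x. sum_list (fst x)) (strict.hook_boxes {0<..} h)"
  by (simp add: b_gf_def b_hook_def strict.gf_hook_boxes distinct_partitions_eq)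

text \<open>The missing parts are the \<open>k\<close> odd numbers from \<open>c\<close> to
  \<open>c + 2 * k - 2\<close>. Their series is the reciprocal of the Pochhammer symbol, so removing
  them from all odd parts multiplies by that symbol.\<close>

lemma multi_G_around_gap:
  assumes "odd c"
  shows "multi.G {p. odd p \<and> c + 2 * k \<le> p} UNIV * multi.G {p. odd p \<and> p < c} UNIV =
    qpoch_inf (- fps_X) fps_X * qpoch (fps_X ^ c) (fps_X\<^sup>2) k"
proof -
  let ?H = "{p. odd p \<and> c + 2 * k \<le> p}" and ?L = "{p. odd p \<and> p < c}"
  have "{p. odd p} = ?H \<union> (progression c 2 k \<union> ?L)"
    using assms by (auto simp: progression_2)
  then have "multi.G {p. odd p} UNIV = multi.G (?H \<union> (progression c 2 k \<union> ?L)) UNIV"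
    by simp
  also have "\<dots> = multi.G ?H UNIV * multi.G (progression c 2 k \<union> ?L) UNIV"
    using assms by (intro multi.G_append) (auto simp: progression_2)
  also have "multi.G (progression c 2 k \<union> ?L) UNIV =
      multi.G (progression c 2 k) UNIV * multi.G ?L UNIV"
    using assms by (intro multi.G_append) (auto simp: progression_2)
  finally have "qpoch_inf (- fps_X) fps_X * qpoch (fps_X ^ c) (fps_X\<^sup>2) k =
      multi.G ?H UNIV * multi.G ?L UNIV *
      (multi.G (progression c 2 k) UNIV * qpoch (fps_X ^ c) (fps_X\<^sup>2) k)"
    by (simp add: multi_G_odd mult_ac)
  then show ?thesis
    using multi_G_progression[of c 2 k] assms by (simp add: odd_pos)
qed

text \<open>Here \<open>c\<close> is the least odd number above \<open>j\<close>.\<close>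

lemma multi_term:
  assumes "odd c" "j < c" "c \<le> j + 2" "even j \<Longrightarrow> c = j + 1" and s: "s = c + 2 * k"
  shows "fps_X ^ s * (multi.G {p \<in> {p. odd p}. p \<ge> s} UNIV *
      (multi.G {p \<in> {p. odd p}. s \<ge> p \<and> j < p} {l} * multi.G {p \<in> {p. odd p}. p \<le> j} UNIV)) =
    qpoch_inf (- fps_X) fps_X * (fps_X ^ (s + c * l) * qbinom (fps_X\<^sup>2) (l + k) k *
      qpoch (fps_X ^ c) (fps_X\<^sup>2) k)"
proof -
  \<comment> \<open>If \<open>c = j + 2\<close>, the number \<open>j + 1\<close> in between is
    even.\<close>
  have j: "p \<le> j \<longleftrightarrow> p < c" if "odd p" for p
  proof -
    have "c = j + 1 \<or> c = j + 2"
      using assms by linarith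
    moreover have "p \<noteq> j + 1" if "c = j + 2"
      using that \<open>odd p\<close> assms(1) by auto
    ultimately show ?thesis
      by linarith
  qed
  have "{p \<in> {p. odd p}. p \<ge> s} = {p. odd p \<and> c + 2 * k \<le> p}"
    by (simp add: s)
  moreover have "{p \<in> {p. odd p}. p \<le> j} = {p. odd p \<and> p < c}"
    using j by auto
  \<comment> \<open>The leg may repeat \<open>s\<close>, so it draws on \<open>k + 1\<close> odd
    numbers, one more than the gap contains.\<close>
  moreover have "{p \<in> {p. odd p}. s \<ge> p \<and> j < p} = progression c 2 (Suc k)"
  proof -
    have "p < c + 2 * Suc k \<longleftrightarrow> p \<le> c + 2 * k" "j < p \<longleftrightarrow> c \<le> p" if "odd p" for p
    proof -
      have "p \<noteq> c + 2 * k + 1"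
        using that assms(1) by auto
      then show "p < c + 2 * Suc k \<longleftrightarrow> p \<le> c + 2 * k"
        by auto
      show "j < p \<longleftrightarrow> c \<le> p"
        using j[OF that] by linarith
    qed
    then show ?thesis
      unfolding progression_2[OF assms(1)] s by blast
  qed
  moreover have "multi.G (progression c 2 (Suc k)) {l} =
      fps_X ^ (c * l) * qbinom (fps_X\<^sup>2) (l + k) k"
    using assms(1) by (intro multi_G_progression_length) (auto simp: odd_pos)
  ultimately show ?thesis
    using multi_G_around_gap[OF assms(1), of k] by (simp add: power_add mult_ac)
qed

lemma qbinom_sym: "qbinom q (l + k) l = qbinom q (l + k) k"
  by (simp add: qbinom_def mult.commute)

text \<open>The leg uses \<open>l\<close> of the \<open>l + k\<close> numbers strictly between
  \<open>j\<close> and \<open>s\<close>, while \<open>hi\<close> and \<open>lo\<close> also avoid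
  \<open>s\<close>. Hence the Pochhammer symbol that is divided out has one factor more.\<close>

lemma strict_term:
  assumes s: "s = j + (l + Suc k)"
  shows "fps_X ^ s * (strict.G {p \<in> {0<..}. p > s} UNIV *
      (strict.G {p \<in> {0<..}. s > p \<and> j < p} {l} * strict.G {p \<in> {0<..}. p \<le> j} UNIV)) =
    qpoch_inf (- fps_X) fps_X * (fps_X ^ (s + (j + 1) * l + l * (l - 1) div 2) *
      qbinom fps_X (l + k) l * inverse (qpoch (- (fps_X ^ (j + 1))) fps_X (l + Suc k)))"
proof -
  let ?H = "{s<..}" and ?L = "{0<..j}" and ?M = "progression (j + 1) 1 (l + Suc k)"
    and ?Q = "qpoch (- (fps_X ^ (j + 1))) fps_X (l + Suc k)"
  have sets: "{p \<in> {0<..}. p > s} = ?H" "{p \<in> {0<..}. p \<le> j} = ?L"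
      "{p \<in> {0<..}. s > p \<and> j < p} = progression (j + 1) 1 (l + k)"
    by (auto simp: progression_1 s)
  have "{0<..} = ?H \<union> (?M \<union> ?L)"
    by (auto simp: progression_1 s)
  then have "strict.G {0<..} UNIV = strict.G (?H \<union> (?M \<union> ?L)) UNIV"
    by simp
  also have "\<dots> = strict.G ?H UNIV * strict.G (?M \<union> ?L) UNIV"
    by (intro strict.G_append) (auto simp: progression_1 s)
  also have "strict.G (?M \<union> ?L) UNIV = strict.G ?M UNIV * strict.G ?L UNIV"
    by (intro strict.G_append) (auto simp: progression_1)
  also have "strict.G ?M UNIV = ?Q"
    using strict_G_progression[of "j + 1" 1] by simp
  finally have D: "qpoch_inf (- fps_X) fps_X = strict.G ?H UNIV * strict.G ?L UNIV * ?Q"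
    by (simp only: strict_G_positive mult_ac)
  have "?Q * inverse ?Q = 1"
    using qpoch_neg_unit[of "j + 1" 1 "l + Suc k"] by (intro inverse_mult_eq_1') simp
  then have HL: "strict.G ?H UNIV * strict.G ?L UNIV = qpoch_inf (- fps_X) fps_X * inverse ?Q"
    unfolding D by (simp only: mult.assoc mult_1_right)
  have M: "strict.G (progression (j + 1) 1 (l + k)) {l} =
      fps_X ^ ((j + 1) * l + l * (l - 1) div 2) * qbinom fps_X (l + k) l"
    using strict_G_progression_length[of "j + 1" 1 l k] by (simp only: qbinom_sym) simp
  have "fps_X ^ s * (strict.G ?H UNIV *
      (strict.G (progression (j + 1) 1 (l + k)) {l} * strict.G ?L UNIV)) =
      (strict.G ?H UNIV * strict.G ?L UNIV) *
      (fps_X ^ s * strict.G (progression (j + 1) 1 (l + k)) {l})"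
    by (simp only: mult_ac)
  then show ?thesis
    unfolding sets HL M by (simp only: add.assoc power_add[of _ s] mult_ac)
qed

text \<open>Separates the leg lengths by the parity of \<open>h - l\<close>, written as
  \<open>2 * k + 1\<close> or \<open>2 * k + 2\<close>; this \<open>k\<close> becomes the outer
  summation index in the odd case.\<close>

lemma sum_split_parity:
  fixes f :: "nat \<Rightarrow> 'a :: comm_monoid_add"
  shows "(\<Sum>l<h. f l) = (\<Sum>k<(h + 1) div 2. f (h - 2 * k - 1)) + (\<Sum>k<h div 2. f (h - 2 * k - 2))"
proof -
  have "(\<Sum>i<h. g i) = (\<Sum>k<(h + 1) div 2. g (2 * k)) + (\<Sum>k<h div 2. g (2 * k + 1))"
    for g :: "nat \<Rightarrow> 'a"
  proof (induction h)
    case (Suc h)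
    then show ?case
      by (cases "even h") (auto elim!: evenE oddE simp: add_ac)
  qed simp
  from this[of "\<lambda>i. f (h - Suc i)"] show ?thesis
    by (simp add: sum.nat_diff_reindex diff_diff_add)
qed

lemma nat_ceiling_half: "nat \<lceil>real h / 2\<rceil> = (h + 1) div 2"
proof (cases "even h")
  case True
  then show ?thesis
    by (auto elim!: evenE)
next
  case False
  then obtain k where "h = 2 * k + 1"
    by (auto elim!: oddE)
  moreover have "\<lceil>real (2 * k + 1) / 2\<rceil> = int k + 1"
    by (rule ceiling_unique) (auto simp: field_simps)
  ultimately show ?thesis
    by (simp add: nat_add_distrib)
qed

lemma nat_floor_half: "nat \<lfloor>real h / 2\<rfloor> = h div 2"
  using floor_divide_of_nat_eq[of h 2, where 'a = real] by simp

lemma a_gf_sum: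
  "a_gf h =
    (\<Sum>k<(h + 1) div 2. \<Sum>m. qpoch_inf (- fps_X) fps_X *
      (fps_X ^ h * qbinom (fps_X\<^sup>2) (h - k - 1) k) *
      (qpoch (fps_X ^ (2 * m + 1)) (fps_X\<^sup>2) k * fps_X ^ ((2 * h - 4 * k) * m))) +
    (\<Sum>k<h div 2. \<Sum>m. qpoch_inf (- fps_X) fps_X *
      (fps_X ^ (3 * h - 4 * k - 3) * qbinom (fps_X\<^sup>2) (h - k - 2) k) *
      (qpoch (fps_X ^ (2 * m + 3)) (fps_X\<^sup>2) k * fps_X ^ ((2 * h - 4 * k - 2) * m)))"
    (is "_ = (\<Sum>k<(h + 1) div 2. \<Sum>m. ?A k m) + (\<Sum>k<h div 2. \<Sum>m. ?B k m)")
proof -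
  \<comment> \<open>The row length \<open>j + (h - l)\<close> must be odd, so \<open>j\<close> has
    parity opposite to that of \<open>h - l\<close>.\<close>
  define r where "r l m = (if odd (h - l) then 2 * m else 2 * m + 1)" for l m :: nat
  \<comment> \<open>Here \<open>c\<close> is the least odd number above \<open>j = r l m\<close>,
    and \<open>k\<close> counts the odd numbers from \<open>c\<close> up to but excluding the row
    length \<open>c + 2 * k\<close>.\<close>
  define F where "F l m = (
    let k = (h - l - 1) div 2; c = (if odd (h - l) then 2 * m + 1 else 2 * m + 3) in
    qpoch_inf (- fps_X) fps_X * (fps_X ^ (c + 2 * k + c * l) * qbinom (fps_X\<^sup>2) (l + k) k *
      qpoch (fps_X ^ c) (fps_X\<^sup>2) k))" for l m
  have "a_gf h = (\<Sum>l<h. \<Sum>m. F l m)"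
    unfolding a_gf_eq
  proof (rule multi.gf_hook_boxes_sum)
    fix l assume l: "l < h"
    show "inj (r l)"
      by (auto simp: inj_def r_def)
    show "range (r l) = {j. j + (h - l) \<in> {p. odd p}}"
    proof -
      have "range ((*) 2) = {j :: nat. even j}" "range (\<lambda>m. 2 * m + 1) = {j :: nat. odd j}"
        by (auto elim: evenE oddE)
      then show ?thesis
        by (cases "odd (h - l)") (simp_all add: r_def del: even_diff_nat)
    qed
    fix m :: nat
    let ?k = "(h - l - 1) div 2" and ?c = "if odd (h - l) then 2 * m + 1 else 2 * m + 3"
    have s: "r l m + (h - l) = ?c + 2 * ?k"
    proof (cases "odd (h - l)")
      case True
      then obtain i where "h - l = 2 * i + 1"
        by (rule oddE)
      then show ?thesis
        by (simp add: r_def)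
    next
      case False
      with l obtain i where "h - l = 2 * Suc i"
        by (metis evenE mult_0_right not0_implies_Suc zero_less_diff less_irrefl)
      then show ?thesis
        by (simp add: r_def)
    qed
    show "F l m = (let j = r l m; s = j + (h - l) in fps_X ^ s *
      (multi.G {p \<in> {p. odd p}. s \<le> p} UNIV *
      (multi.G {p \<in> {p. odd p}. p \<le> s \<and> j < p} {l} * multi.G {p \<in> {p. odd p}. p \<le> j} UNIV)))"
      unfolding F_def Let_def s
      by (rule multi_term[OF _ _ _ _ refl, symmetric]) (auto simp: r_def simp del: even_diff_nat)
  qed
  also have "\<dots> = (\<Sum>k<(h + 1) div 2. \<Sum>m. F (h - 2 * k - 1) m) +
      (\<Sum>k<h div 2. \<Sum>m. F (h - 2 * k - 2) m)"
    by (rule sum_split_parity)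
  also have "(\<Sum>k<(h + 1) div 2. \<Sum>m. F (h - 2 * k - 1) m) = (\<Sum>k<(h + 1) div 2. \<Sum>m. ?A k m)"
  proof (rule sum.cong)
    fix k assume "k \<in> {..<(h + 1) div 2}"
    then have "2 * k + 1 \<le> h"
      by auto
    then obtain l where h: "h = 2 * k + 1 + l"
      using le_Suc_ex by blast
    have "F l m = ?A k m" for m
    proof -
      \<comment> \<open>The exponent is \<open>(2 * m + 1) * (l + 1) + 2 * k\<close>: its constant
        part is \<open>h\<close>, and \<open>m\<close> has coefficient
        \<open>2 * (l + 1)\<close>.\<close>
      have "2 * m + 1 + 2 * k + (2 * m + 1) * l = h + (2 * h - 4 * k) * m"
        by (simp add: h algebra_simps)
      moreover have "l + k = h - k - 1"
        by (simp add: h)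
      moreover have "(h - l - 1) div 2 = k" "odd (h - l)"
        by (simp_all add: h)
      ultimately have "F l m = qpoch_inf (- fps_X) fps_X * (fps_X ^ (h + (2 * h - 4 * k) * m) *
          qbinom (fps_X\<^sup>2) (h - k - 1) k * qpoch (fps_X ^ (2 * m + 1)) (fps_X\<^sup>2) k)"
        by (simp only: F_def Let_def if_True not_False_eq_True)
      then show ?thesis
        by (simp only: power_add[of _ h] mult_ac)
    qed
    then show "(\<Sum>m. F (h - 2 * k - 1) m) = (\<Sum>m. ?A k m)"
      by (simp add: h)
  qed simp
  also have "(\<Sum>k<h div 2. \<Sum>m. F (h - 2 * k - 2) m) = (\<Sum>k<h div 2. \<Sum>m. ?B k m)"
  proof (rule sum.cong)
    fix k assume "k \<in> {..<h div 2}"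
    then have "2 * k + 2 \<le> h"
      by auto
    then obtain l where h: "h = 2 * k + 2 + l"
      using le_Suc_ex by blast
    have "F l m = ?B k m" for m
    proof -
      have "2 * m + 3 + 2 * k + (2 * m + 3) * l = 3 * h - 4 * k - 3 + (2 * h - 4 * k - 2) * m"
        by (simp add: h algebra_simps)
      moreover have "l + k = h - k - 2"
        by (simp add: h)
      moreover have "(h - l - 1) div 2 = k" "\<not> odd (h - l)"
        by (simp_all add: h)
      ultimately have "F l m = qpoch_inf (- fps_X) fps_X *
          (fps_X ^ (3 * h - 4 * k - 3 + (2 * h - 4 * k - 2) * m) *
          qbinom (fps_X\<^sup>2) (h - k - 2) k * qpoch (fps_X ^ (2 * m + 3)) (fps_X\<^sup>2) k)"
        by (simp only: F_def Let_def if_False not_True_eq_False)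
      then show ?thesis
        unfolding power_add[of _ "3 * h - 4 * k - 3"] by (simp only: mult_ac)
    qed
    then show "(\<Sum>m. F (h - 2 * k - 2) m) = (\<Sum>m. ?B k m)"
      by (simp add: h)
  qed simp
  finally show ?thesis .
qed

lemma b_gf_sum:
  "b_gf h = (\<Sum>l<(h + 1) div 2. \<Sum>m. qpoch_inf (- fps_X) fps_X *
    (fps_X ^ (h + l * (l - 1) div 2) * qbinom fps_X (h - l - 1) l) *
    (inverse (qpoch (- (fps_X ^ (m + 1))) fps_X (h - l)) * fps_X ^ ((l + 1) * m)))"
    (is "_ = (\<Sum>l<(h + 1) div 2. \<Sum>m. ?A l m)")
proof -
  \<comment> \<open>A leg of \<open>l\<close> distinct rows must fit among the
    \<open>h - l - 1\<close> lengths strictly between \<open>j\<close> and \<open>s\<close>, which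
    forces \<open>2 * l < h\<close>; longer legs contribute nothing.\<close>
  define F where "F l m = (if l < (h + 1) div 2 then ?A l m else 0)" for l m
  have "b_gf h = (\<Sum>l<h. \<Sum>m. F l m)"
    unfolding b_gf_eq
  proof (rule strict.gf_hook_boxes_sum)
    fix l assume l: "l < h"
    show "inj (\<lambda>m :: nat. m)"
      by simp
    show "range (\<lambda>m :: nat. m) = {j. j + (h - l) \<in> {0<..}}"
      using l by simp
    fix m
    have "F l m = fps_X ^ (m + (h - l)) * (strict.G {p \<in> {0<..}. m + (h - l) < p} UNIV *
      (strict.G {p \<in> {0<..}. p < m + (h - l) \<and> m < p} {l} * strict.G {p \<in> {0<..}. p \<le> m} UNIV))"
    proof (cases "l < (h + 1) div 2")
      case True
      then have "2 * l + 1 \<le> h"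
        by auto
      then obtain k where h: "h = 2 * l + 1 + k"
        using le_Suc_ex by blast
      have s: "m + (h - l) = m + (l + Suc k)"
        by (simp add: h)
      have e: "m + (h - l) + (m + 1) * l + l * (l - 1) div 2 =
          h + l * (l - 1) div 2 + (l + 1) * m"
        by (simp add: h)
      have n: "h - l = l + Suc k" "l + Suc k - 1 = l + k"
        by (simp_all add: h)
      show ?thesis
        unfolding strict_term[OF s] e F_def if_P[OF True] unfolding n
        by (simp only: power_add mult_ac)
    next
      case False
      have "{p \<in> {0<..}. p < m + (h - l) \<and> m < p} = progression (m + 1) 1 (h - l - 1)"
        using l by (auto simp: progression_1)
      moreover have "strict.G (progression (m + 1) 1 (h - l - 1)) {l} = 0"
        using False l by (intro strict_G_progression_length_0) auto
      ultimately show ?thesis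
        using False by (simp only: F_def if_False mult_zero_left mult_zero_right)
    qed
    then show "F l m = (let j = m; s = j + (h - l) in fps_X ^ s *
      (strict.G {p \<in> {0<..}. s < p} UNIV *
      (strict.G {p \<in> {0<..}. p < s \<and> j < p} {l} * strict.G {p \<in> {0<..}. p \<le> j} UNIV)))"
      by (simp only: Let_def)
  qed
  also have "\<dots> = (\<Sum>l<(h + 1) div 2. \<Sum>m. F l m)"
    by (rule sum.mono_neutral_right) (auto simp: F_def)
  also have "\<dots> = (\<Sum>l<(h + 1) div 2. \<Sum>m. ?A l m)"
    by (rule sum.cong) (simp_all add: F_def)
  finally show ?thesis .
qed

theorem theorem2p1:
  fixes h :: nat
  assumes "h \<ge> 1"
  shows "let q = (fps_X :: rat fps) in
    a_gf h =
      qpoch_inf (- q) q *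
        (\<Sum>j<nat \<lceil>real h / 2\<rceil>. q ^ h * qbinom (q\<^sup>2) (h - j - 1) j *
          (\<Sum>m. qpoch (q ^ (2 * m + 1)) (q\<^sup>2) j * q ^ ((2 * h - 4 * j) * m)))
    + qpoch_inf (- q) q *
        (\<Sum>j<nat \<lfloor>real h / 2\<rfloor>. q ^ (3 * h - 4 * j - 3) * qbinom (q\<^sup>2) (h - j - 2) j *
          (\<Sum>m. qpoch (q ^ (2 * m + 3)) (q\<^sup>2) j * q ^ ((2 * h - 4 * j - 2) * m)))
    \<and>
    b_gf h =
      qpoch_inf (- q) q *
        (\<Sum>j<nat \<lceil>real h / 2\<rceil>. q ^ (h + j * (j - 1) div 2) * qbinom q (h - j - 1) j *
          (\<Sum>m. q ^ ((j + 1) * m) / qpoch (- (q ^ (m + 1))) q (h - j)))"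
proof -
  let ?q = "fps_X :: rat fps"
  \<comment> \<open>Factors independent of \<open>m\<close> move out of the infinite sums. The
    ranges of \<open>j\<close> make the coefficient of \<open>m\<close> in each exponent positive,
    which secures summability.\<close>
  have a1: "(\<Sum>m. C * (qpoch (?q ^ (2 * m + 1)) (?q\<^sup>2) j * ?q ^ ((2 * h - 4 * j) * m))) =
      C * (\<Sum>m. qpoch (?q ^ (2 * m + 1)) (?q\<^sup>2) j * ?q ^ ((2 * h - 4 * j) * m))"
    if "j \<in> {..<(h + 1) div 2}" for j C
    using that by (intro fps_suminf_mult_powers) auto
  have a2: "(\<Sum>m. C * (qpoch (?q ^ (2 * m + 3)) (?q\<^sup>2) j * ?q ^ ((2 * h - 4 * j - 2) * m))) =
      C * (\<Sum>m. qpoch (?q ^ (2 * m + 3)) (?q\<^sup>2) j * ?q ^ ((2 * h - 4 * j - 2) * m))"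
    if "j \<in> {..<h div 2}" for j C
    using that by (intro fps_suminf_mult_powers) auto
  have b: "(\<Sum>m. C * (inverse (qpoch (- (?q ^ (m + 1))) ?q n) * ?q ^ ((j + 1) * m))) =
      C * (\<Sum>m. ?q ^ ((j + 1) * m) / qpoch (- (?q ^ (m + 1))) ?q n)" for j n C
  proof -
    have "?q ^ ((j + 1) * m) / qpoch (- (?q ^ (m + 1))) ?q n =
        inverse (qpoch (- (?q ^ (m + 1))) ?q n) * ?q ^ ((j + 1) * m)" for m
      using qpoch_neg_unit[of "m + 1" 1 n] by (subst fps_divide_unit) (simp_all add: mult.commute)
    then show ?thesis
      by (simp only:) (rule fps_suminf_mult_powers, simp)
  qed
  show ?thesis
    unfolding Let_def nat_ceiling_half nat_floor_half a_gf_sum b_gf_sum sum_distrib_left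
    by (intro conjI arg_cong2[where f = "(+)"] sum.cong refl;
        simp only: a1 a2 b; simp only: mult.assoc)
qed

end
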